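(* Let $\mathcal{A}=\{H_1,\dots,H_n\}$ be a central essential hyperplane arrangement in $V=\mathbb{R}^\ell$ with complexified complement $M(\mathcal{A})$, and for $1\le k\le\ell$ let $\Sigma_k$ be the set of all systems of half-spaces $h(\bm{\varepsilon})$, $\bm{\varepsilon}\in\{+,-\}^n$, that are consistent at every $X\in L(\mathcal{A})$ with $\operatorname{codim}X\le k$. (1) Suppose that $k\ge 2$ (with $k+1\le\ell$) satisfies $\Sigma_k\supsetneq\Sigma_{k+1}$. Then $\pi_k(M(\mathcal{A}))\neq 0$. (2) If $M(\mathcal{A})$ is a $K(\pi,1)$ space, then $\Sigma_2=\Sigma_3=\dots=\Sigma_\ell$.
   Context: A hyperplane arrangement $\mathcal{A}=\{H_1,\dots,H_n\}$ is a finite set of (distinct) hyperplanes in $V=\mathbb{R}^\ell$; it is central and essential if all $H_i$ are linear hyperplanes and $\bigcap_{i=1}^n H_i=\{0\}$. Fix a linear form $\alpha_i\in V^*$ with $H_i=\ker\alpha_i$ for each $i$, and put $H_i^{+}=\{x\in V\mid\alpha_i(x)>0\}$, $H_i^{-}=\{x\in V\mid\alpha_i(x)<0\}$. A sign vector $\bm{\varepsilon}=(\varepsilon_1,\dots,\varepsilon_n)\in\{+,-\}^n$ determines the system of half-spaces $h(\bm{\varepsilon})=(H_1^{\varepsilon_1},\dots,H_n^{\varepsilon_n})$. Let $L(\mathcal{A})=\{\bigcap_{H\in\mathcal{B}}H\mid\mathcal{B}\subset\mathcal{A}\}$ be the set of intersections (with $V$ the intersection of the empty family). For $X\in L(\mathcal{A})$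 let $\mathcal{A}_X=\{H\in\mathcal{A}\mid H\supset X\}$. The system $h(\bm{\varepsilon})$ is consistent at $X$ if $\bigcap_{H_i\in\mathcal{A}_X}H_i^{\varepsilon_i}\neq\emptyset$. One has $\Sigma_1\supset\Sigma_2\supset\dots\supset\Sigma_\ell$. The complexified complement is $M(\mathcal{A})=\mathbb{C}^\ell\setminus\bigcup_{i=1}^n (H_i\otimes\mathbb{C})$. It is a $K(\pi,1)$ space if $\pi_j(M(\mathcal{A}))=0$ for all $j\ge2$. *)

theory Defs
  imports "HOL-Analysis.Analysis" "HOL-Algebra.Group"
begin

section \<open>Homotopy groups\<close>

definition cube :: "nat \<Rightarrow> (nat \<Rightarrow> real) topology" where
  "cube k = subtopology (Euclidean_space k) {x. \<forall>i<k. 0 \<le> x i \<and> x i \<le> 1}"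

definition cube_boundary :: "nat \<Rightarrow> (nat \<Rightarrow> real) set" where
  "cube_boundary k = {x \<in> topspace (cube k). \<exists>i<k. x i = 0 \<or> x i = 1}"

definition based_cube_maps :: "nat \<Rightarrow> 'a topology \<Rightarrow> 'a \<Rightarrow> ((nat \<Rightarrow> real) \<Rightarrow> 'a) set" where
  "based_cube_maps k X p = {f. continuous_map (cube k) X f \<and> (\<forall>x\<in>cube_boundary k. f x = p)}"

text \<open>Homotopy relative to the boundary. Values outside the cube are not constrained, so two
  functions that agree on the cube are related.\<close>

definition based_homotopic ::
    "nat \<Rightarrow> 'a topology \<Rightarrow> 'a \<Rightarrow> (((nat \<Rightarrow> real) \<Rightarrow> 'a) \<times> ((nat \<Rightarrow> real) \<Rightarrow> 'a)) set" where
  "based_homotopic k X p =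
     {(f, g). f \<in> based_cube_maps k X p \<and> g \<in> based_cube_maps k X p \<and>
        homotopic_with (\<lambda>h. \<forall>x\<in>cube_boundary k. h x = p) (cube k) X f g}"

definition cube_concat ::
    "((nat \<Rightarrow> real) \<Rightarrow> 'a) \<Rightarrow> ((nat \<Rightarrow> real) \<Rightarrow> 'a) \<Rightarrow> (nat \<Rightarrow> real) \<Rightarrow> 'a" where
  "cube_concat f g x =
     (if x 0 \<le> 1/2 then f (x(0 := 2 * x 0)) else g (x(0 := 2 * x 0 - 1)))"

text \<open>The multiplication is meaningful for \<open>k \<ge> 1\<close>; for \<open>k = 0\<close> only the carrier (the set of path
  components) is.\<close>

definition homotopy_group :: "nat \<Rightarrow> 'a topology \<Rightarrow> 'a \<Rightarrow> ((nat \<Rightarrow> real) \<Rightarrow> 'a) set monoid" where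
  "homotopy_group k X p =
     \<lparr> carrier = based_cube_maps k X p // based_homotopic k X p,
       mult = (\<lambda>C D. \<Union>f\<in>C. \<Union>g\<in>D. based_homotopic k X p `` {cube_concat f g}),
       one = based_homotopic k X p `` {\<lambda>x. p} \<rparr>"

definition homotopy_group_zero :: "nat \<Rightarrow> 'a topology \<Rightarrow> 'a \<Rightarrow> bool" where
  "homotopy_group_zero k X p \<longleftrightarrow>
     carrier (homotopy_group k X p) = {\<one>\<^bsub>homotopy_group k X p\<^esub>}"

definition K_pi_1_space :: "'a topology \<Rightarrow> bool" where
  "K_pi_1_space X \<longleftrightarrow> (\<forall>p\<in>topspace X. \<forall>j\<ge>2. homotopy_group_zero j X p)"

section \<open>Central essential arrangements\<close>

definition codim :: "(real ^ 'l) set \<Rightarrow> nat" where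
  "codim X = CARD('l) - dim X"

definition linear_hyperplane :: "(real ^ 'l) set \<Rightarrow> bool" where
  "linear_hyperplane H \<longleftrightarrow> subspace H \<and> dim H + 1 = CARD('l)"

definition central_essential_arrangement :: "(real ^ 'l) set set \<Rightarrow> bool" where
  "central_essential_arrangement A \<longleftrightarrow>
     finite A \<and> (\<forall>H\<in>A. linear_hyperplane H) \<and> \<Inter>A = {0}"

definition intersections :: "(real ^ 'l) set set \<Rightarrow> (real ^ 'l) set set" where
  "intersections A = {\<Inter>B | B. B \<subseteq> A}"

definition localization :: "(real ^ 'l) set set \<Rightarrow> (real ^ 'l) set \<Rightarrow> (real ^ 'l) set set" where
  "localization A X = {H \<in> A. X \<subseteq> H}"

text \<open>\<open>H \<otimes> \<complex> = H + \<i>H\<close> inside \<open>\<complex>\<^sup>\<ell>\<close>.\<close>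

definition complexification :: "(real ^ 'l) set \<Rightarrow> (complex ^ 'l) set" where
  "complexification H = {(\<chi> j. Complex (x $ j) (y $ j)) | x y. x \<in> H \<and> y \<in> H}"

definition complexified_complement :: "(real ^ 'l) set set \<Rightarrow> (complex ^ 'l) set" where
  "complexified_complement A = UNIV - (\<Union>H\<in>A. complexification H)"

section \<open>Systems of half-spaces\<close>

datatype sign = Pos | Neg

fun half_space :: "(real ^ 'l \<Rightarrow> real) \<Rightarrow> sign \<Rightarrow> (real ^ 'l) set" where
  "half_space a Pos = {x. a x > 0}"
| "half_space a Neg = {x. a x < 0}"

text \<open>A system of half-spaces is an \<open>n\<close>-tuple, i.e. a function restricted to \<open>{1..n}\<close>.\<close>

definition half_space_system ::
    "nat \<Rightarrow> (nat \<Rightarrow> real ^ 'l \<Rightarrow> real) \<Rightarrow> (nat \<Rightarrow> sign) \<Rightarrow> nat \<Rightarrow> (real ^ 'l) set" where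
  "half_space_system n \<alpha> \<epsilon> = (\<lambda>i\<in>{1..n}. half_space (\<alpha> i) (\<epsilon> i))"

definition consistent_at ::
    "(real ^ 'l) set set \<Rightarrow> nat \<Rightarrow> (nat \<Rightarrow> (real ^ 'l) set) \<Rightarrow> (nat \<Rightarrow> (real ^ 'l) set)
      \<Rightarrow> (real ^ 'l) set \<Rightarrow> bool" where
  "consistent_at A n H h X \<longleftrightarrow> (\<Inter>i\<in>{i\<in>{1..n}. H i \<in> localization A X}. h i) \<noteq> {}"

definition consistent_systems ::
    "(real ^ 'l) set set \<Rightarrow> nat \<Rightarrow> (nat \<Rightarrow> (real ^ 'l) set) \<Rightarrow> (nat \<Rightarrow> real ^ 'l \<Rightarrow> real)
      \<Rightarrow> nat \<Rightarrow> (nat \<Rightarrow> (real ^ 'l) set) set" where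
  "consistent_systems A n H \<alpha> k =
     {half_space_system n \<alpha> \<epsilon> | \<epsilon>.
        \<forall>X\<in>intersections A. codim X \<le> k \<longrightarrow> consistent_at A n H (half_space_system n \<alpha> \<epsilon>) X}"

end

theory Submission
  imports Defs
begin

text \<open>
  Suppose that \<open>h(\<epsilon>)\<close> is consistent at all flats of codimension at most \<open>k\<close>, but not at some flat
  \<open>X\<close> of codimension \<open>k + 1\<close>. Let \<open>\<beta>\<^sub>i\<close> be the form \<open>\<alpha>\<^sub>i\<close> with the sign \<open>\<epsilon>\<^sub>i\<close>, let
  \<open>I\<close> be the set of indices of hyperplanes through \<open>X\<close>, and let \<open>U\<close> be the orthogonal complement of
  \<open>X\<close>, of dimension \<open>k + 1\<close>.

  A nonzero \<open>v \<in> U\<close> lies on a flat that is strictly larger than \<open>X\<close>, so consistency there gives a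
  vector \<open>w\<close> with \<open>\<beta>\<^sub>i w > 0\<close> for all \<open>i \<in> I\<close> with \<open>\<beta>\<^sub>i v = 0\<close>. Such a \<open>w\<close> can be chosen
  continuously in \<open>v\<close> (\<open>continuous_choice_of_direction\<close>). With \<open>x\<^sub>0\<close> a generic point of \<open>X\<close> and
  \<open>\<delta>\<close> small, \<open>v \<mapsto> x\<^sub>0 + \<delta> (v + \<i> w(v))\<close> is a map of a \<open>k\<close>-sphere around \<open>0\<close> in \<open>U\<close> into the
  complement. This sphere is essential.

  Indeed, suppose that it extends to a ball \<open>D\<close>, and write the extension as \<open>x\<^sub>0 + \<delta> F\<close>.
  The numbers \<open>\<beta>\<^sub>i(F(x))\<close>, \<open>i \<in> I\<close>, are nonzero and have continuous arguments \<open>\<theta>\<^sub>i\<close> on \<open>D\<close>. On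
  the sphere, \<open>\<beta>\<^sub>i(F(v)) = \<beta>\<^sub>i v + \<i> \<beta>\<^sub>i(w(v))\<close> never lies on the negative imaginary axis, and as
  the sphere is connected \<open>\<theta>\<^sub>i\<close> can be normalized to take values in \<open>(-\<pi>/2, 3\<pi>/2)\<close> there. The key is
  to rotate \<open>F\<close> by the least argument \<open>\<psi> = min\<^sub>i \<theta>\<^sub>i\<close>. The real part of \<open>exp(- \<i> \<psi>) F\<close>, projected
  to \<open>U\<close>, vanishes nowhere on \<open>D\<close>, since \<open>\<beta>\<^sub>i\<close> is positive on it for the minimizing \<open>i\<close>. On
  the sphere some \<open>\<beta>\<^sub>j v\<close> is nonnegative, because \<open>h(\<epsilon>)\<close> is inconsistent at \<open>X\<close>, and hence
  \<open>- \<pi>/2 < \<psi> \<le> \<pi>/2\<close>. The form \<open>\<beta>\<^sub>i\<close> of least argument then shows that the rotation by \<open>t \<psi>\<close>,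
  \<open>0 \<le> t \<le> 1\<close>, is a homotopy of nowhere vanishing maps on the sphere, from the identity to a map that
  extends to \<open>D\<close> without zeros. Brouwer's theorem forbids this (\<open>sphere_of_inconsistent_system_not_extendable\<close>).

  It remains to see that a vanishing \<open>k\<close>-th homotopy group, at whatever base point, makes every map of the
  \<open>k\<close>-sphere extend to the ball (\<open>sphere_map_extends_if_homotopy_group_zero\<close>). The complement is
  open and path connected, so the homotopy extension property allows the map to be made constant on all
  of the boundary of a cube but one face, and on that face it is a based cube map.
\<close>

section \<open>Boxes spanned by orthonormal families\<close>

lemma continuous_on_linear_form:
  fixes a :: "'a::euclidean_space \<Rightarrow> 'b::real_normed_vector"
  shows "linear a \<Longrightarrow> continuous_on S a"
  using linear_continuous_on linear_conv_bounded_linear by blast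

lemma continuous_on_Max_family:
  fixes f :: "'i \<Rightarrow> 'a::topological_space \<Rightarrow> real"
  assumes "finite I" "I \<noteq> {}" "\<And>i. i \<in> I \<Longrightarrow> continuous_on S (f i)"
  shows "continuous_on S (\<lambda>x. Max ((\<lambda>i. f i x) ` I))"
  using assms
proof (induction rule: finite_ne_induct)
  case (singleton i)
  then show ?case by simp
next
  case (insert i J)
  have "Max ((\<lambda>i. f i x) ` insert i J) = max (f i x) (Max ((\<lambda>i. f i x) ` J))" for x
    using insert by simp
  then show ?case
    using insert by (auto intro!: continuous_intros)
qed

text \<open>The family has the \<open>k + 1\<close> members \<open>b 0, \<dots>, b k\<close>: the box that they span plays the role of the
  ball bounded by a \<open>k\<close>-sphere. A box rather than a round ball, because its faces are the cubes on which
  elements of the \<open>k\<close>-th homotopy group are defined.\<close>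

locale orthonormal_family =
  fixes b :: "nat \<Rightarrow> 'a::euclidean_space" and k :: nat
  assumes inner_b: "\<And>i j. i \<le> k \<Longrightarrow> j \<le> k \<Longrightarrow> b i \<bullet> b j = (if i = j then 1 else 0)"
begin

definition frame_space :: "'a set" where
  "frame_space = span (b ` {..k})"

definition proj :: "'a \<Rightarrow> 'a" where
  "proj x = (\<Sum>i\<le>k. (x \<bullet> b i) *\<^sub>R b i)"

definition box_norm :: "'a \<Rightarrow> real" where
  "box_norm x = Max ((\<lambda>i. \<bar>x \<bullet> b i\<bar>) ` {..k})"

definition unit_box :: "'a set" where
  "unit_box = {x \<in> frame_space. box_norm x \<le> 1}"

definition box_boundary :: "'a set" where
  "box_boundary = {x \<in> frame_space. box_norm x = 1}"

lemma subspace_frame_space: "subspace frame_space"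
  by (simp add: frame_space_def)

lemma b_in_frame_space: "i \<le> k \<Longrightarrow> b i \<in> frame_space"
  by (simp add: frame_space_def span_base)

lemma linear_proj: "linear proj"
  unfolding proj_def
  by (intro linear_compose_sum ballI linear_compose_scale_right linearI)
     (auto simp: inner_add_left algebra_simps)

lemma continuous_on_proj: "continuous_on S proj"
  using linear_proj by (rule continuous_on_linear_form)

lemma proj_in_frame_space: "proj x \<in> frame_space"
  unfolding proj_def by (intro subspace_sum subspace_frame_space subspace_mul b_in_frame_space) auto

lemma inner_sum_b: "j \<le> k \<Longrightarrow> (\<Sum>i\<le>k. c i *\<^sub>R b i) \<bullet> b j = c j"
proof -
  assume j: "j \<le> k"
  have "(\<Sum>i\<le>k. c i *\<^sub>R b i) \<bullet> b j = (\<Sum>i\<le>k. if i = j then c j else 0)"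
    unfolding inner_sum_left by (rule sum.cong) (auto simp: inner_b j)
  then show ?thesis using j by simp
qed

lemma proj_id: 
  assumes "x \<in> frame_space" shows "proj x = x"
proof -
  have "x \<in> span (b ` {..k})" using assms by (simp add: frame_space_def)
  then show ?thesis
  proof (induction rule: span_induct)
    case base
    show ?case
      unfolding subspace_def
      using linear_proj by (auto simp: linear_0 linear_add linear_scale)
  next
    case (step x)
    then obtain j where j: "j \<le> k" "x = b j" by auto
    have "proj (b j) = (\<Sum>i\<le>k. if i = j then b j else 0)"
      unfolding proj_def by (rule sum.cong) (auto simp: inner_b j)
    then show ?case using j by simp
  qed
qed

lemma abs_inner_le_box_norm: "i \<le> k \<Longrightarrow> \<bar>x \<bullet> b i\<bar> \<le> box_norm x"
  unfolding box_norm_def by (intro Max_ge) auto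

lemma box_norm_le_iff: "box_norm x \<le> r \<longleftrightarrow> (\<forall>i\<le>k. \<bar>x \<bullet> b i\<bar> \<le> r)"
  unfolding box_norm_def by (subst Max_le_iff) auto

lemma box_norm_attained: obtains i where "i \<le> k" "box_norm x = \<bar>x \<bullet> b i\<bar>"
proof -
  have "box_norm x \<in> (\<lambda>i. \<bar>x \<bullet> b i\<bar>) ` {..k}"
    unfolding box_norm_def by (intro Max_in) auto
  then show ?thesis using that by auto
qed

lemma box_norm_scale: "box_norm (c *\<^sub>R x) = \<bar>c\<bar> * box_norm x"
proof (rule antisym)
  show "box_norm (c *\<^sub>R x) \<le> \<bar>c\<bar> * box_norm x"
    unfolding box_norm_le_iff by (auto simp: abs_mult intro!: mult_left_mono abs_inner_le_box_norm)
  obtain i where "i \<le> k" "box_norm x = \<bar>x \<bullet> b i\<bar>" by (rule box_norm_attained)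
  then show "\<bar>c\<bar> * box_norm x \<le> box_norm (c *\<^sub>R x)"
    using abs_inner_le_box_norm[of i "c *\<^sub>R x"] by (simp add: abs_mult)
qed

lemma continuous_on_box_norm: "continuous_on S box_norm"
  unfolding box_norm_def by (intro continuous_on_Max_family continuous_intros) auto

lemma box_norm_pos: 
  assumes "x \<in> frame_space" "x \<noteq> 0" shows "0 < box_norm x"
proof (rule ccontr)
  assume "\<not> 0 < box_norm x"
  then have "box_norm x \<le> 0" by simp
  then have "\<forall>i\<le>k. x \<bullet> b i = 0" unfolding box_norm_le_iff by auto
  then have "proj x = 0" by (simp add: proj_def)
  then show False using assms proj_id by simp
qed

lemma box_boundary_subset_box: "box_boundary \<subseteq> unit_box"
  by (auto simp: unit_box_def box_boundary_def)

lemma box_boundary_nonzero: "x \<in> box_boundary \<Longrightarrow> x \<noteq> 0"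
  by (auto simp: box_boundary_def box_norm_def image_constant_conv)

lemma closed_box_boundary: "closed box_boundary" and closed_box: "closed unit_box"
proof -
  have "closed {x. box_norm x = 1}" "closed {x. box_norm x \<le> 1}"
    by (intro closed_Collect_eq closed_Collect_le continuous_on_box_norm continuous_intros)+
  then show "closed box_boundary" "closed unit_box"
    unfolding box_boundary_def unit_box_def
    using closed_subspace[OF subspace_frame_space] by (auto simp: Collect_conj_eq)
qed

lemma compact_box: "compact unit_box"
proof -
  have "norm x \<le> real (Suc k)" if "x \<in> unit_box" for x
  proof -
    have "x = proj x" "\<forall>i\<le>k. \<bar>x \<bullet> b i\<bar> \<le> 1"
      using that box_norm_le_iff by (auto simp: unit_box_def proj_id)
    then have "norm x = norm (\<Sum>i\<le>k. (x \<bullet> b i) *\<^sub>R b i)"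
      by (simp add: proj_def)
    also have "\<dots> \<le> (\<Sum>i\<le>k. norm ((x \<bullet> b i) *\<^sub>R b i))"
      by (rule norm_sum)
    also have "\<dots> \<le> (\<Sum>i\<le>k. 1)"
      using \<open>\<forall>i\<le>k. \<bar>x \<bullet> b i\<bar> \<le> 1\<close> by (intro sum_mono) (simp add: norm_eq_sqrt_inner inner_b)
    finally show ?thesis by simp
  qed
  then show ?thesis
    by (meson closed_box bounded_iff compact_eq_bounded_closed)
qed

lemma convex_box: "convex unit_box"
proof -
  have "unit_box = frame_space \<inter> (\<Inter>i\<in>{..k}. {x. b i \<bullet> x \<le> 1} \<inter> {x. b i \<bullet> x \<ge> - 1})"
    by (auto simp: unit_box_def box_norm_le_iff abs_le_iff inner_commute[of "b _"])
  moreover have "convex frame_space" by (rule subspace_imp_convex[OF subspace_frame_space])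
  ultimately show ?thesis
    by (auto intro!: convex_Int convex_INT convex_halfspace_le convex_halfspace_ge)
qed

lemma zero_in_box: "0 \<in> unit_box"
  by (auto simp: unit_box_def box_norm_def subspace_0 subspace_frame_space image_constant_conv)

lemma normalize_in_box_boundary:
  assumes "x \<in> frame_space" "x \<noteq> 0" shows "(1 / box_norm x) *\<^sub>R x \<in> box_boundary"
  using assms box_norm_pos[OF assms]
  by (auto simp: box_boundary_def box_norm_scale subspace_mul subspace_frame_space)

text \<open>If \<open>E\<close> existed, the map that sends \<open>x\<close> to the antipode of the normalization of \<open>E x\<close> would
  have a fixed point by Brouwer's theorem. That point would lie on the boundary and equal its own
  antipode.\<close>

lemma no_nonvanishing_extension:
  assumes "continuous_on unit_box E" "E \<in> unit_box \<rightarrow> frame_space - {0}"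
    "\<And>v. v \<in> box_boundary \<Longrightarrow> E v = v"
  shows False
proof -
  have nz: "box_norm (E x) > 0" if "x \<in> unit_box" for x
    using assms(2) that box_norm_pos by (metis Pi_mem DiffD1 DiffD2 singletonI)
  define r where "r x = - ((1 / box_norm (E x)) *\<^sub>R E x)" for x
  have minus_in_boundary: "- v \<in> box_boundary" if "v \<in> box_boundary" for v
    using that box_norm_scale[of "-1" v] by (auto simp: box_boundary_def subspace_neg subspace_frame_space)
  have r_in_boundary: "r x \<in> box_boundary" if "x \<in> unit_box" for x
    unfolding r_def by (intro minus_in_boundary normalize_in_box_boundary) (use assms(2) that in auto)
  have "continuous_on unit_box (\<lambda>x. box_norm (E x))"
    using continuous_on_compose2[OF continuous_on_box_norm[of UNIV] assms(1)] by simp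
  then have "continuous_on unit_box r"
    unfolding r_def by (intro continuous_intros assms(1) ballI) (auto, metis nz less_irrefl)
  moreover have "r \<in> unit_box \<rightarrow> unit_box" "unit_box \<noteq> {}"
    using r_in_boundary box_boundary_subset_box zero_in_box by auto
  ultimately obtain x where x: "x \<in> unit_box" "r x = x"
    using brouwer[OF compact_box convex_box] by metis
  then have "x \<in> box_boundary" using r_in_boundary by metis
  then have "E x = x" "box_norm x = 1" using assms by (auto simp: box_boundary_def)
  then have "x = - x" using x by (simp add: r_def)
  then have "2 *\<^sub>R x = 0" by (metis add.right_inverse scaleR_2)
  then have "x = 0" by simp
  then show False using box_boundary_nonzero \<open>x \<in> box_boundary\<close> by blast
qed

lemma dim_frame_space: "dim frame_space = Suc k"
proof -
  have inj: "inj_on b {..k}"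
    by (rule inj_onI) (metis atMost_iff inner_b zero_neq_one)
  have "pairwise orthogonal (b ` {..k})" "0 \<notin> b ` {..k}"
    unfolding pairwise_def orthogonal_def using inner_b
    by (auto, metis inner_b inner_zero_left zero_neq_one)
  then have "independent (b ` {..k})"
    using pairwise_orthogonal_independent by blast
  then show ?thesis
    unfolding frame_space_def dim_span by (simp add: dim_eq_card_independent card_image inj)
qed

lemma connected_box_boundary:
  assumes "k \<ge> 1" shows "connected box_boundary"
proof -
  have "aff_dim frame_space \<noteq> 1"
    using aff_dim_subspace[OF subspace_frame_space] dim_frame_space assms by simp
  then have "connected (frame_space - {0})"
    by (intro path_connected_imp_connected path_connected_punctured_convex
        subspace_imp_convex subspace_frame_space)
  moreover have "box_boundary = (\<lambda>x. (1 / box_norm x) *\<^sub>R x) ` (frame_space - {0})"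
  proof
    show "box_boundary \<subseteq> (\<lambda>x. (1 / box_norm x) *\<^sub>R x) ` (frame_space - {0})"
    proof
      fix x assume "x \<in> box_boundary"
      then have "x = (1 / box_norm x) *\<^sub>R x" "x \<in> frame_space - {0}"
        using box_boundary_nonzero by (auto simp: box_boundary_def)
      then show "x \<in> (\<lambda>x. (1 / box_norm x) *\<^sub>R x) ` (frame_space - {0})" by blast
    qed
  qed (auto intro: normalize_in_box_boundary)
  moreover have "continuous_on (frame_space - {0}) (\<lambda>x. (1 / box_norm x) *\<^sub>R x)"
    by (intro continuous_intros continuous_on_box_norm) (use box_norm_pos in force)
  ultimately show ?thesis
    using connected_continuous_image by metis
qed

text \<open>All faces of the box except the bottom one, \<open>x \<bullet> b k = - 1\<close>.\<close>

definition box_lid :: "'a set" where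
  "box_lid = {x \<in> box_boundary. x \<bullet> b k = 1 \<or> (\<exists>i<k. \<bar>x \<bullet> b i\<bar> = 1)}"

text \<open>The convex box is retracted onto the lid by radial projection \<open>r\<close> from the point \<open>- 2 b k\<close>
  below it. The \<open>box_norm\<close> of \<open>s x\<close> is the factor by which \<open>x + 2 b k\<close> has to be divided for the
  projected point to lie on the side walls or on the top face, which is at distance \<open>3\<close> from the
  centre of projection.\<close>

lemma contractible_box_lid: "contractible box_lid"
proof -
  define s where "s x = x + ((2 - 2 * (x \<bullet> b k)) / 3) *\<^sub>R b k" for x
  define r where "r x = (1 / box_norm (s x)) *\<^sub>R (x + 2 *\<^sub>R b k) - 2 *\<^sub>R b k" for x
  have s_k: "s x \<bullet> b k = (x \<bullet> b k + 2) / 3" for x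
    by (simp add: s_def inner_add_left inner_b field_simps)
  have s_i: "s x \<bullet> b i = x \<bullet> b i" if "i < k" for x i
    using that by (simp add: s_def inner_add_left inner_b)
  have r_k: "r x \<bullet> b k = (x \<bullet> b k + 2) / box_norm (s x) - 2" for x
    by (simp add: r_def inner_add_left inner_diff_left inner_b)
  have r_i: "r x \<bullet> b i = (x \<bullet> b i) / box_norm (s x)" if "i < k" for x i
    using that by (simp add: r_def inner_add_left inner_diff_left inner_b)
  have box_coord: "\<bar>x \<bullet> b i\<bar> \<le> 1" if "x \<in> unit_box" "i \<le> k" for x i
    using that box_norm_le_iff by (auto simp: unit_box_def)
  have s_pos: "box_norm (s x) > 0" if "x \<in> unit_box" for x
    using abs_inner_le_box_norm[of k "s x"] box_coord[OF that, of k] by (simp add: s_k)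
  have s_le: "box_norm (s x) \<le> 1" if "x \<in> unit_box" for x
    unfolding box_norm_le_iff
  proof (intro allI impI)
    fix i assume "i \<le> k"
    then show "\<bar>s x \<bullet> b i\<bar> \<le> 1"
      using box_coord[OF that, of i] s_k[of x] s_i[of i x] by (cases "i = k") auto
  qed
  have r_in_lid: "r x \<in> box_lid" if "x \<in> unit_box" for x
  proof -
    have frame_space: "r x \<in> frame_space"
      unfolding r_def using that b_in_frame_space
      by (intro subspace_diff subspace_mul subspace_add subspace_frame_space) (auto simp: unit_box_def)
    have le: "\<bar>r x \<bullet> b i\<bar> \<le> 1" if "i \<le> k" for i
    proof (cases "i = k")
      case True
      have k: "\<bar>x \<bullet> b k\<bar> \<le> 1" using box_coord \<open>x \<in> unit_box\<close> by blast
      have "(x \<bullet> b k + 2) / 3 \<le> box_norm (s x)"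
        using abs_inner_le_box_norm[of k "s x"] by (simp add: s_k)
      moreover have "box_norm (s x) \<le> x \<bullet> b k + 2"
        using s_le[OF \<open>x \<in> unit_box\<close>] k by simp
      ultimately have "(x \<bullet> b k + 2) / box_norm (s x) \<le> 3" "1 \<le> (x \<bullet> b k + 2) / box_norm (s x)"
        using s_pos[OF \<open>x \<in> unit_box\<close>] by (auto simp: field_simps)
      then show ?thesis using True by (simp add: r_k abs_le_iff)
    next
      case False
      then have "i < k" using that by simp
      then show ?thesis
        using abs_inner_le_box_norm[of i "s x"] s_pos[OF \<open>x \<in> unit_box\<close>] by (simp add: r_i s_i)
    qed
    obtain i where i: "i \<le> k" "box_norm (s x) = \<bar>s x \<bullet> b i\<bar>" by (rule box_norm_attained)
    have att: "r x \<bullet> b k = 1 \<or> (\<exists>i<k. \<bar>r x \<bullet> b i\<bar> = 1)"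
    proof (cases "i = k")
      case True
      have "\<bar>x \<bullet> b k\<bar> \<le> 1" using box_coord \<open>x \<in> unit_box\<close> by blast
      then have "box_norm (s x) = (x \<bullet> b k + 2) / 3" using i True by (auto simp: s_k)
      then have "(x \<bullet> b k + 2) / box_norm (s x) = 3"
        using s_pos[OF that] by (simp add: field_simps)
      then show ?thesis by (simp add: r_k)
    next
      case False
      then have "i < k" using i by simp
      then have "\<bar>r x \<bullet> b i\<bar> = 1"
        using i s_pos[OF that] by (simp add: r_i s_i)
      then show ?thesis using \<open>i < k\<close> by blast
    qed
    have "box_norm (r x) = 1"
    proof (rule antisym)
      show "box_norm (r x) \<le> 1" using le box_norm_le_iff by blast
      show "1 \<le> box_norm (r x)"
        using att abs_inner_le_box_norm[of _ "r x"] by (metis abs_one dual_order.refl less_imp_le)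
    qed
    then show ?thesis using frame_space att by (auto simp: box_lid_def box_boundary_def)
  qed
  have r_id: "r x = x" if "x \<in> box_lid" for x
  proof -
    have "x \<in> unit_box" using that box_boundary_subset_box by (auto simp: box_lid_def)
    have "1 \<le> box_norm (s x)"
      using that abs_inner_le_box_norm[of _ "s x"] s_k[of x] s_i[of _ x]
      unfolding box_lid_def by (smt (verit) abs_divide divide_self_if less_imp_le mem_Collect_eq order_refl)
    then have "box_norm (s x) = 1" using s_le[OF \<open>x \<in> unit_box\<close>] by simp
    then show ?thesis by (simp add: r_def)
  qed
  have "continuous_on unit_box s" unfolding s_def by (intro continuous_intros) auto
  then have "continuous_on unit_box (\<lambda>x. box_norm (s x))"
    by (intro continuous_on_compose2[OF continuous_on_box_norm[of UNIV]]) auto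
  then have "continuous_on unit_box r"
    unfolding r_def by (intro continuous_intros ballI) (auto, metis s_pos less_irrefl)
  moreover have "box_lid \<subseteq> unit_box" using box_boundary_subset_box by (auto simp: box_lid_def)
  ultimately have "box_lid retract_of unit_box"
    unfolding retract_of_def retraction_def using r_in_lid r_id by blast
  then show ?thesis
    using retract_of_contractible convex_imp_contractible convex_box by blast
qed

lemma closed_box_lid: "closed box_lid"
proof -
  have "box_lid = box_boundary \<inter> ({x. x \<bullet> b k = 1} \<union> (\<Union>i\<in>{..<k}. {x. \<bar>x \<bullet> b i\<bar> = 1}))"
    by (auto simp: box_lid_def)
  moreover have "closed {x. x \<bullet> b k = 1}" "closed {x. \<bar>x \<bullet> b i\<bar> = 1}" for i
    by (intro closed_Collect_eq continuous_intros)+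
  ultimately show ?thesis
    using closed_box_boundary by (auto intro!: closed_Int closed_Un closed_UN)
qed

end

section \<open>The least argument\<close>

text \<open>On \<open>S\<close> there is a continuous logarithm \<open>g\<close>. On \<open>D\<close>, where the values avoid the negative
  imaginary axis, it is compared with the principal branch \<open>h\<close> rotated by \<open>\<pi>/2\<close>, whose imaginary
  part has the required range. The two branches differ by a multiple of \<open>2\<pi>\<i>\<close>, which is constant because
  \<open>D\<close> is connected and can be subtracted on all of \<open>S\<close>.\<close>

lemma continuous_argument_avoiding_ray:
  fixes f :: "'a::real_normed_vector \<Rightarrow> complex"
  assumes "continuous_on S f" "contractible S" and nz: "\<And>x. x \<in> S \<Longrightarrow> f x \<noteq> 0"
    and D: "D \<subseteq> S" "connected D"
    and ray: "\<And>x. x \<in> D \<Longrightarrow> Re (f x) = 0 \<Longrightarrow> Im (f x) > 0"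
  obtains \<theta> where "continuous_on S \<theta>"
    "\<And>x. x \<in> S \<Longrightarrow> f x = of_real (cmod (f x)) * cis (\<theta> x)"
    "\<And>x. x \<in> D \<Longrightarrow> - pi / 2 < \<theta> x \<and> \<theta> x < 3 * pi / 2"
proof -
  obtain g where g: "continuous_on S g" "\<And>x. x \<in> S \<Longrightarrow> f x = exp (g x)"
    using continuous_logarithm_on_contractible[OF assms(1-3)] by blast
  define h where "h x = Ln (- \<i> * f x) + \<i> * (pi / 2)" for x
  have slit: "- \<i> * f x \<notin> \<real>\<^sub>\<le>\<^sub>0" if "x \<in> D" for x
    using ray[OF that] by (auto simp: complex_nonpos_Reals_iff)
  have exp_h: "exp (h x) = f x" if "x \<in> D" for x
  proof -
    have "exp (h x) = (- \<i> * f x) * exp (\<i> * (pi / 2))"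
      unfolding h_def exp_add using that D nz by (subst exp_Ln) auto
    also have "exp (\<i> * (pi / 2)) = \<i>"
      by (metis exp_pi_i exp_Euler cis_conv_exp cis_pi_half of_real_divide of_real_numeral)
    finally have "exp (h x) = - (\<i> * \<i>) * f x" by (simp only: mult_ac mult_minus_left mult_minus_right)
    then show ?thesis by simp
  qed
  have f_D: "continuous_on D f" "continuous_on D g"
    using assms(1) g(1) D(1) continuous_on_subset by blast+
  have "continuous_on D h"
    unfolding h_def by (intro continuous_intros continuous_on_Ln f_D slit)
  then have cont: "continuous_on D (\<lambda>x. g x - h x)"
    by (intro continuous_intros f_D)
  have period: "\<exists>n::int. g x - h x = of_int (2 * n) * pi * \<i>" if x: "x \<in> D" for x
  proof -
    have "exp (g x) = exp (h x)" using g(2) exp_h x D by auto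
    then show ?thesis unfolding exp_eq by (auto simp: algebra_simps)
  qed
  have "(\<lambda>x. g x - h x) constant_on D"
  proof (rule continuous_discrete_range_constant[OF D(2) cont])
    fix x assume "x \<in> D"
    show "\<exists>e>0. \<forall>y. y \<in> D \<and> g y - h y \<noteq> g x - h x \<longrightarrow> e \<le> cmod (g y - h y - (g x - h x))"
    proof (intro exI[of _ 1] conjI allI impI)
      fix y assume y: "y \<in> D \<and> g y - h y \<noteq> g x - h x"
      obtain m n :: int where mn: "g x - h x = of_int (2 * m) * pi * \<i>"
          "g y - h y = of_int (2 * n) * pi * \<i>"
        using period \<open>x \<in> D\<close> y by blast
      have "n \<noteq> m" using y mn by auto
      then have "1 \<le> \<bar>real_of_int (n - m)\<bar>" by linarith
      have "g y - h y - (g x - h x) = of_real (2 * pi * real_of_int (n - m)) * \<i>"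
        using mn by (simp add: algebra_simps)
      then have "cmod (g y - h y - (g x - h x)) = 2 * pi * \<bar>real_of_int (n - m)\<bar>"
        by (simp only: norm_mult norm_of_real) (simp add: abs_mult)
      also have "\<dots> \<ge> 2 * pi * 1"
        using \<open>1 \<le> \<bar>real_of_int (n - m)\<bar>\<close> by (intro mult_left_mono) auto
      finally show "1 \<le> cmod (g y - h y - (g x - h x))"
        using pi_ge_two by simp
    qed simp
  qed
  then obtain c0 where c0: "\<And>x. x \<in> D \<Longrightarrow> g x - h x = c0"
    unfolding constant_on_def by blast
  define c where "c = (if D = {} then 0 else c0)"
  have exp_c: "exp c = 1"
  proof (cases "D = {}")
    case False
    then obtain x where "x \<in> D" by blast
    then have "c = g x - h x" "exp (g x) = exp (h x)"
      using c0 c_def exp_h g(2) D by auto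
    then show ?thesis by (simp add: exp_diff)
  qed (simp add: c_def)
  have c: "g x - c = h x" if "x \<in> D" for x
    using c0[OF that] that by (auto simp: c_def)
  define \<theta> where "\<theta> x = Im (g x - c)" for x
  show thesis
  proof
    show "continuous_on S \<theta>"
      unfolding \<theta>_def by (intro continuous_intros g(1))
    show "f x = of_real (cmod (f x)) * cis (\<theta> x)" if "x \<in> S" for x
    proof -
      have "f x = exp (g x - c)" using g(2)[OF that] exp_c by (simp add: exp_diff)
      then show ?thesis
        by (simp add: \<theta>_def exp_eq_polar norm_mult)
    qed
    show "- pi / 2 < \<theta> x \<and> \<theta> x < 3 * pi / 2" if "x \<in> D" for x
    proof -
      have "\<theta> x = Im (Ln (- \<i> * f x)) + pi / 2"
        by (simp add: \<theta>_def c[OF that] h_def)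
      moreover have "- \<i> * f x \<noteq> 0" using nz D that by auto
      moreover have "Im (Ln (- \<i> * f x)) \<noteq> pi"
        using slit[OF that] Im_Ln_eq_pi[OF \<open>- \<i> * f x \<noteq> 0\<close>] by (auto simp: complex_nonpos_Reals_iff)
      ultimately show ?thesis
        using mpi_less_Im_Ln[of "- \<i> * f x"] Im_Ln_le_pi[of "- \<i> * f x"] by force
    qed
  qed
qed

context orthonormal_family begin

text \<open>\<open>R + \<i> S\<close> is the hypothetical extension to the box of a sphere \<open>v + \<i> w(v)\<close>. The forms need to be
  invariant under \<open>proj\<close>, since the ambient space may be larger than the span of the box and Brouwer's
  theorem applies to a map into that span.\<close>

lemma sphere_of_inconsistent_system_not_extendable:
  fixes \<beta> :: "'i \<Rightarrow> 'a \<Rightarrow> real" and R S :: "'a \<Rightarrow> 'a"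
  assumes k: "k \<ge> 1" and I: "finite I"
    and lin: "\<And>i. i \<in> I \<Longrightarrow> linear (\<beta> i)"
    and proj: "\<And>i x. i \<in> I \<Longrightarrow> \<beta> i (proj x) = \<beta> i x"
    and cont: "continuous_on unit_box R" "continuous_on unit_box S"
    and nz: "\<And>i x. i \<in> I \<Longrightarrow> x \<in> unit_box \<Longrightarrow> \<beta> i (R x) = 0 \<Longrightarrow> \<beta> i (S x) \<noteq> 0"
    and R_on_boundary: "\<And>v. v \<in> box_boundary \<Longrightarrow> proj (R v) = v"
    and pos: "\<And>i v. i \<in> I \<Longrightarrow> v \<in> box_boundary \<Longrightarrow> \<beta> i v = 0 \<Longrightarrow> \<beta> i (S v) > 0"
    and inconsistent: "\<And>y. \<exists>i\<in>I. \<beta> i y \<le> 0"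
  shows False
proof -
  have I_ne: "I \<noteq> {}" using inconsistent by blast
  have \<beta>R: "\<beta> i (R v) = \<beta> i v" if "i \<in> I" "v \<in> box_boundary" for i v
    using proj[OF that(1), of "R v"] R_on_boundary[OF that(2)] by simp
  define f where "f i x = Complex (\<beta> i (R x)) (\<beta> i (S x))" for i x
  have cont_lin: "continuous_on UNIV (\<beta> i)" if "i \<in> I" for i
    using lin[OF that] by (rule continuous_on_linear_form)
  have cont_f: "continuous_on unit_box (f i)" if "i \<in> I" for i
    unfolding f_def
    by (intro continuous_on_Complex continuous_on_compose2[OF cont_lin[OF that] cont(1)]
        continuous_on_compose2[OF cont_lin[OF that] cont(2)]) auto
  have f_nz: "f i x \<noteq> 0" if "i \<in> I" "x \<in> unit_box" for i x
    using nz[OF that] by (auto simp: f_def complex_eq_iff)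
  have f_ray: "Im (f i v) > 0" if "i \<in> I" "v \<in> box_boundary" "Re (f i v) = 0" for i v
    using pos[OF that(1,2)] that by (simp add: f_def \<beta>R)
  have "\<exists>\<theta>. continuous_on unit_box \<theta> \<and>
      (\<forall>x\<in>unit_box. f i x = of_real (cmod (f i x)) * cis (\<theta> x)) \<and>
      (\<forall>v\<in>box_boundary. - pi / 2 < \<theta> v \<and> \<theta> v < 3 * pi / 2)" if "i \<in> I" for i
    by (rule continuous_argument_avoiding_ray[OF cont_f[OF that]
          convex_imp_contractible[OF convex_box] f_nz[OF that] box_boundary_subset_box connected_box_boundary[OF k]
          f_ray[OF that]]) auto
  then obtain \<theta> where \<theta>: "\<And>i. i \<in> I \<Longrightarrow> continuous_on unit_box (\<theta> i)"
    "\<And>i x. i \<in> I \<Longrightarrow> x \<in> unit_box \<Longrightarrow> f i x = of_real (cmod (f i x)) * cis (\<theta> i x)"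
    "\<And>i v. i \<in> I \<Longrightarrow> v \<in> box_boundary \<Longrightarrow> - pi / 2 < \<theta> i v \<and> \<theta> i v < 3 * pi / 2"
    by metis
  \<comment> \<open>The minimum of the arguments.\<close>
  define \<psi> where "\<psi> x = - Max ((\<lambda>i. - \<theta> i x) ` I)" for x
  have cont_\<psi>: "continuous_on unit_box \<psi>"
    unfolding \<psi>_def by (intro continuous_on_minus continuous_on_Max_family I I_ne \<theta>(1))
  have \<psi>_le: "\<psi> x \<le> \<theta> i x" if "i \<in> I" for i x
  proof -
    have "- \<theta> i x \<le> Max ((\<lambda>i. - \<theta> i x) ` I)" using that I by (intro Max_ge) auto
    then show ?thesis by (simp add: \<psi>_def)
  qed
  have \<psi>_attained: "\<exists>i\<in>I. \<psi> x = \<theta> i x" for x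
  proof -
    have "Max ((\<lambda>i. - \<theta> i x) ` I) \<in> (\<lambda>i. - \<theta> i x) ` I" using I I_ne by (intro Max_in) auto
    then show ?thesis by (auto simp: \<psi>_def)
  qed
  have \<psi>_range: "- pi / 2 < \<psi> v \<and> \<psi> v \<le> pi / 2" if v: "v \<in> box_boundary" for v
  proof -
    \<comment> \<open>Inconsistency is used at \<open>- v\<close>, which is not in the intersection of the half-spaces.\<close>
    obtain j where j: "j \<in> I" "\<beta> j (- v) \<le> 0" using inconsistent by blast
    have "0 \<le> Re (f j v)"
      using j v lin[OF j(1)] by (simp add: f_def \<beta>R linear_neg)
    also have "Re (f j v) = cmod (f j v) * cos (\<theta> j v)"
      using arg_cong[OF \<theta>(2)[OF j(1), of v], of Re] v box_boundary_subset_box by auto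
    finally have "0 \<le> cos (\<theta> j v)"
      using f_nz[OF j(1), of v] v box_boundary_subset_box by (auto simp: zero_le_mult_iff)
    \<comment> \<open>The cosine is negative on the remaining part \<open>(\<pi>/2, 3\<pi>/2)\<close> of the range of \<open>\<theta> j\<close>.\<close>
    have "\<theta> j v \<le> pi / 2"
    proof (rule ccontr)
      assume "\<not> \<theta> j v \<le> pi / 2"
      then have "0 < cos (\<theta> j v - pi)"
        using \<theta>(3)[OF j(1) v] by (intro cos_gt_zero_pi) auto
      then show False using \<open>0 \<le> cos (\<theta> j v)\<close> by simp
    qed
    then show ?thesis
      using \<psi>_le[OF j(1), of v] \<psi>_attained[of v] \<theta>(3)[OF _ v] by force
  qed
  \<comment> \<open>The projected real part of \<open>exp(- \<i> t \<psi>) (R + \<i> S)\<close>.\<close>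
  define G where "G t x = proj (cos (t * \<psi> x) *\<^sub>R R x + sin (t * \<psi> x) *\<^sub>R S x)" for t x
  have G_\<beta>: "\<exists>i\<in>I. \<exists>r>0. \<beta> i (G t x) = r * cos ((1 - t) * \<psi> x)" if x: "x \<in> unit_box" for t x
  proof -
    obtain i where i: "i \<in> I" "\<psi> x = \<theta> i x" using \<psi>_attained by blast
    have f: "f i x = of_real (cmod (f i x)) * cis (\<psi> x)" using \<theta>(2)[OF i(1) x] i by simp
    have "\<beta> i (R x) = Re (f i x)" "\<beta> i (S x) = Im (f i x)" by (auto simp: f_def)
    then have re: "\<beta> i (R x) = cmod (f i x) * cos (\<psi> x)"
      and im: "\<beta> i (S x) = cmod (f i x) * sin (\<psi> x)"
      using arg_cong[OF f, of Re] arg_cong[OF f, of Im] by simp_all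
    have "\<beta> i (G t x) = cos (t * \<psi> x) * \<beta> i (R x) + sin (t * \<psi> x) * \<beta> i (S x)"
      unfolding G_def proj[OF i(1)] using lin[OF i(1)] by (simp add: linear_add linear_scale)
    also have "\<dots> = cmod (f i x) * cos ((1 - t) * \<psi> x)"
      unfolding re im left_diff_distrib cos_diff by (simp add: algebra_simps)
    finally show ?thesis using i f_nz[OF i(1) x] by (metis zero_less_norm_iff)
  qed
  have G_in_frame_space: "G t x \<in> frame_space" for t x
    by (simp add: G_def proj_in_frame_space)
  have \<beta>0: "\<beta> i 0 = 0" if "i \<in> I" for i
    using lin[OF that] linear_0 by blast
  have G1_nonzero: "G 1 x \<noteq> 0" if "x \<in> unit_box" for x
  proof
    assume "G 1 x = 0"
    with G_\<beta>[OF that, of 1] \<beta>0 show False by force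
  qed
  have G_boundary_nonzero: "G t v \<noteq> 0" if "v \<in> box_boundary" "0 \<le> t" "t \<le> 1" for t v
  proof (cases "t = 0")
    case True
    then show ?thesis using that R_on_boundary box_boundary_nonzero by (simp add: G_def)
  next
    case False
    have vQ: "v \<in> unit_box" using that box_boundary_subset_box by auto
    have "\<bar>\<psi> v\<bar> \<le> pi / 2" using \<psi>_range[OF that(1)] by auto
    then have "(1 - t) * \<bar>\<psi> v\<bar> \<le> (1 - t) * (pi / 2)"
      using that by (intro mult_left_mono) auto
    then have "\<bar>(1 - t) * \<psi> v\<bar> \<le> (1 - t) * (pi / 2)"
      using that by (simp add: abs_mult)
    also have "\<dots> < pi / 2" using False that by simp
    finally have "0 < cos ((1 - t) * \<psi> v)"
      by (intro cos_gt_zero_pi) auto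
    show ?thesis
    proof
      assume "G t v = 0"
      with G_\<beta>[OF vQ, of t] \<beta>0 \<open>0 < cos ((1 - t) * \<psi> v)\<close> show False by force
    qed
  qed
  have cont_G: "continuous_on ({0..1} \<times> unit_box) (\<lambda>z. G (fst z) (snd z))"
  proof -
    have c: "continuous_on ({0..1::real} \<times> unit_box) (\<lambda>z. h (snd z))" if "continuous_on unit_box h" 
      for h :: "'a \<Rightarrow> 'c::topological_space"
      by (rule continuous_on_compose2[OF that]) (auto intro: continuous_intros)
    show ?thesis
      unfolding G_def
      by (rule continuous_on_compose2[OF continuous_on_proj[of UNIV]])
         (auto intro!: continuous_intros c cont cont_\<psi>)
  qed
  have hom: "homotopic_with_canon (\<lambda>x. True) box_boundary (frame_space - {0}) (G 1) (G 0)"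
  proof (rule homotopic_with_symD)
    have "continuous_on ({0..1} \<times> box_boundary) (\<lambda>z. G (fst z) (snd z))"
      using cont_G by (rule continuous_on_subset) (use box_boundary_subset_box in auto)
    then show "homotopic_with_canon (\<lambda>x. True) box_boundary (frame_space - {0}) (G 0) (G 1)"
      unfolding homotopic_with_def
      by (intro exI[of _ "\<lambda>z. G (fst z) (snd z)"]) (auto simp: G_in_frame_space G_boundary_nonzero)
  qed
  have cont_G1: "continuous_on unit_box (G 1)"
  proof -
    have "continuous_on unit_box (\<lambda>x. (\<lambda>z. G (fst z) (snd z)) (1, x))"
      by (rule continuous_on_compose2[OF cont_G]) (auto intro!: continuous_intros)
    then show ?thesis by simp
  qed
  have anr: "ANR (frame_space - {0})"
    by (rule ANR_openin[OF convex_imp_ANR[OF subspace_imp_convex[OF subspace_frame_space]]])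
       (simp add: openin_delete)
  have cl: "closedin (top_of_set unit_box) box_boundary"
    using box_boundary_subset_box closed_box_boundary by (simp add: closed_subset)
  have "G 1 \<in> unit_box \<rightarrow> frame_space - {0}" using G_in_frame_space G1_nonzero by blast
  then obtain E where E: "continuous_on unit_box E" "E ` unit_box \<subseteq> frame_space - {0}"
      "\<And>v. v \<in> box_boundary \<Longrightarrow> E v = G 0 v"
    using Borsuk_homotopy_extension_homotopic[OF cl disjI2[OF anr] cont_G1 _ hom] by metis
  show False
  proof (rule no_nonvanishing_extension[OF E(1)])
    show "E \<in> unit_box \<rightarrow> frame_space - {0}" using E(2) by blast
    show "E v = v" if "v \<in> box_boundary" for v
      using E(3)[OF that] R_on_boundary[OF that] by (simp add: G_def)
  qed
qed

end

section \<open>Vanishing homotopy groups and extension of sphere maps\<close>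

lemma topspace_cube: "topspace (cube k) = {x. (\<forall>i\<ge>k. x i = 0) \<and> (\<forall>i<k. 0 \<le> x i \<and> x i \<le> 1)}"
  by (auto simp: cube_def topspace_Euclidean_space)

text \<open>The topology of the cube is a subspace topology of the function type, which is a topological space
  as a type. Hence continuity of maps out of it can be treated with \<open>continuous_on\<close>.\<close>

lemma cube_eq_top_of_set: "cube k = top_of_set (topspace (cube k))"
  unfolding topspace_cube
  by (simp add: cube_def Euclidean_space_def euclidean_product_topology subtopology_subtopology Collect_conj_eq)

lemma null_homotopy_of_homotopy_group_zero:
  assumes "homotopy_group_zero k X p" "g \<in> based_cube_maps k X p"
  shows "homotopic_with (\<lambda>h. \<forall>x\<in>cube_boundary k. h x = p) (cube k) X g (\<lambda>x. p)"
proof -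
  let ?R = "based_homotopic k X p"
  have "?R `` {g} \<in> {?R `` {\<lambda>x. p}}"
    using assms quotientI[OF assms(2), of ?R]
    by (simp add: homotopy_group_zero_def homotopy_group_def)
  moreover have "(g, g) \<in> ?R"
    using assms(2) by (simp add: based_homotopic_def based_cube_maps_def)
  ultimately have "(\<lambda>x. p, g) \<in> ?R" by blast
  then show ?thesis
    by (auto simp: based_homotopic_def intro: homotopic_with_symD)
qed

context orthonormal_family begin

text \<open>The lid is contractible and \<open>X\<close> is path connected, so by homotopy extension \<open>f\<close> is homotopic to a
  map \<open>f'\<close> that is constantly \<open>p\<close> on the lid. On the bottom face \<open>f'\<close> is then a based cube map \<open>g\<close>.
  A null homotopy of \<open>g\<close>, with time as the last coordinate of the box, is an extension \<open>F'\<close> of \<open>f'\<close>.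
  Homotopy extension, used once more, turns it into an extension of \<open>f\<close>.\<close>

lemma sphere_map_extends_if_homotopy_group_zero:
  fixes X :: "'c::euclidean_space set" and f :: "'a \<Rightarrow> 'c"
  assumes X: "open X" "path_connected X" "p \<in> X"
    and zero: "homotopy_group_zero k (top_of_set X) p"
    and f: "continuous_on box_boundary f" "f \<in> box_boundary \<rightarrow> X"
  obtains F where "continuous_on unit_box F" "F \<in> unit_box \<rightarrow> X" "\<And>v. v \<in> box_boundary \<Longrightarrow> F v = f v"
proof -
  have anr: "ANR X" using X(1) by (simp add: open_imp_ANR)
  have lid_subset: "box_lid \<subseteq> box_boundary" by (auto simp: box_lid_def)
  have closedin_lid: "closedin (top_of_set box_boundary) box_lid"
    and closedin_boundary: "closedin (top_of_set unit_box) box_boundary"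
    using lid_subset box_boundary_subset_box closed_box_lid closed_box_boundary by (simp_all add: closed_subset)
  obtain c where c: "homotopic_with_canon (\<lambda>x. True) box_lid X f (\<lambda>x. c)"
    by (rule nullhomotopic_from_contractible[of box_lid f X])
       (use f lid_subset contractible_box_lid in \<open>auto intro: continuous_on_subset\<close>)
  have "homotopic_with_canon (\<lambda>x. True) box_lid X f (\<lambda>x. p)"
  proof (cases "box_lid = {}")
    case True
    then show ?thesis using c by (auto simp: homotopic_on_emptyI)
  next
    case False
    then have "c \<in> X" using homotopic_with_imp_subset2[OF c] by auto
    then have "path_component X c p"
      using X by (auto simp: path_connected_component)
    then have "homotopic_with_canon (\<lambda>x. True) box_lid X (\<lambda>x. c) (\<lambda>x. p)"
      by (simp add: homotopic_constant_maps)
    then show ?thesis using c homotopic_with_trans by blast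
  qed
  then obtain f' where f': "homotopic_with_canon (\<lambda>x. True) box_boundary X f f'"
      "continuous_on box_boundary f'" "f' ` box_boundary \<subseteq> X" "\<And>x. x \<in> box_lid \<Longrightarrow> f' x = p"
    using Borsuk_homotopy_extension_homotopic[OF closedin_lid _ f] anr by metis
  define coords where "coords y i = (if i < k then (y \<bullet> b i + 1) / 2 else 0)" for y i
  define bottom where "bottom x = (\<Sum>i\<le>k. (if i < k then 2 * x i - 1 else - 1) *\<^sub>R b i)"
    for x :: "nat \<Rightarrow> real"
  have inner_bottom: "bottom x \<bullet> b i = (if i < k then 2 * x i - 1 else - 1)" if "i \<le> k" for x i
    unfolding bottom_def by (rule inner_sum_b[OF that])
  have bottom_in_boundary: "bottom x \<in> box_boundary" if "x \<in> topspace (cube k)" for x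
  proof -
    have "bottom x \<in> frame_space"
      unfolding bottom_def by (intro subspace_sum subspace_frame_space subspace_mul b_in_frame_space) auto
    moreover have "box_norm (bottom x) \<le> 1"
      using that unfolding box_norm_le_iff by (auto simp: inner_bottom topspace_cube)
    moreover have "1 \<le> box_norm (bottom x)"
      using abs_inner_le_box_norm[of k "bottom x"] by (simp add: inner_bottom)
    ultimately show ?thesis by (simp add: box_boundary_def)
  qed
  have bottom_in_lid: "bottom x \<in> box_lid" if x: "x \<in> cube_boundary k" for x
  proof -
    have "x \<in> topspace (cube k)" using x by (simp add: cube_boundary_def)
    moreover obtain i where "i < k" "x i = 0 \<or> x i = 1" using x by (auto simp: cube_boundary_def)
    ultimately show ?thesis
      using bottom_in_boundary inner_bottom[of i x] by (auto simp: box_lid_def)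
  qed
  have cont_coordinate: "continuous_on S (\<lambda>x. if i < k then 2 * x i - 1 else - 1 :: real)"
    for S :: "(nat \<Rightarrow> real) set" and i
    by (cases "i < k")
       (auto intro!: continuous_intros continuous_on_subset[OF continuous_on_product_coordinates])
  have cont_bottom: "continuous_on S bottom" for S
    unfolding bottom_def by (intro continuous_intros cont_coordinate)
  have coords_cube: "coords y \<in> topspace (cube k)" if "y \<in> unit_box" for y
  proof -
    have "\<forall>i\<le>k. \<bar>y \<bullet> b i\<bar> \<le> 1" using that box_norm_le_iff by (simp add: unit_box_def)
    then show ?thesis by (auto simp: topspace_cube coords_def abs_le_iff) (smt (verit) less_imp_le)
  qed
  have cont_coords: "continuous_on S coords" for S
  proof (rule continuous_on_coordinatewise_then_product)
    show "continuous_on S (\<lambda>y. coords y i)" for i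
      by (cases "i < k") (auto simp: coords_def intro!: continuous_intros)
  qed
  have bottom_coords: "bottom (coords y) = y" if "y \<in> frame_space" "y \<bullet> b k = - 1" for y
  proof -
    have "bottom (coords y) = proj y"
      unfolding bottom_def proj_def coords_def using that(2)
      by (intro sum.cong) (auto simp: field_simps)
    then show ?thesis using proj_id that(1) by simp
  qed
  define g where "g = f' \<circ> bottom"
  have "g \<in> based_cube_maps k (top_of_set X) p"
  proof -
    have "continuous_on (topspace (cube k)) g"
      unfolding g_def comp_def
      by (rule continuous_on_compose2[OF f'(2) cont_bottom]) (auto intro: bottom_in_boundary)
    then have "continuous_map (cube k) (top_of_set X) g"
      using f'(3) bottom_in_boundary by (subst cube_eq_top_of_set) (auto simp: g_def)
    then show ?thesis
      using f'(4) bottom_in_lid by (auto simp: based_cube_maps_def g_def)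
  qed
  then have "homotopic_with (\<lambda>h. \<forall>x\<in>cube_boundary k. h x = p) (cube k) (top_of_set X) g (\<lambda>x. p)"
    by (rule null_homotopy_of_homotopy_group_zero[OF zero])
  then obtain h where h: "continuous_map (prod_topology (top_of_set {0..1::real}) (cube k)) (top_of_set X) h"
      "\<And>x. h (0, x) = g x" "\<And>x. h (1, x) = p"
      "\<And>t x. t \<in> {0..1} \<Longrightarrow> x \<in> cube_boundary k \<Longrightarrow> h (t, x) = p"
    unfolding homotopic_with_def by auto
  have h_cont: "continuous_on ({0..1} \<times> topspace (cube k)) h"
    and h_X: "h \<in> {0..1} \<times> topspace (cube k) \<rightarrow> X"
    using h(1) by (subst (asm) cube_eq_top_of_set; auto)+
  define F' where "F' y = h ((y \<bullet> b k + 1) / 2, coords y)" for y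
  have time: "(y \<bullet> b k + 1) / 2 \<in> {0..1}" if "y \<in> unit_box" for y
  proof -
    have "\<bar>y \<bullet> b k\<bar> \<le> 1" using that box_norm_le_iff by (simp add: unit_box_def)
    then show ?thesis by auto
  qed
  have F'_cont: "continuous_on unit_box F'"
    unfolding F'_def
    by (rule continuous_on_compose2[OF h_cont])
       (use time coords_cube in \<open>auto intro!: continuous_intros cont_coords\<close>)
  have F'_X: "F' \<in> unit_box \<rightarrow> X"
    using h_X time coords_cube by (auto simp: F'_def)
  have F'_on_boundary: "F' y = f' y" if y: "y \<in> box_boundary" for y
  proof (cases "y \<in> box_lid")
    case True
    have yQ: "y \<in> unit_box" using y box_boundary_subset_box by auto
    have "F' y = p"
    proof (cases "y \<bullet> b k = 1")
      case True
      then show ?thesis by (simp add: F'_def h(3))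
    next
      case False
      then obtain i where i: "i < k" "\<bar>y \<bullet> b i\<bar> = 1" using \<open>y \<in> box_lid\<close> by (auto simp: box_lid_def)
      then have "coords y i = 0 \<or> coords y i = 1" by (auto simp: coords_def abs_if split: if_splits)
      then have "coords y \<in> cube_boundary k"
        using i coords_cube[OF yQ] by (auto simp: cube_boundary_def)
      then show ?thesis using h(4) time[OF yQ] by (simp add: F'_def)
    qed
    then show ?thesis using f'(4)[OF True] by simp
  next
    case False
    have yU: "y \<in> frame_space" "box_norm y = 1" using y by (auto simp: box_boundary_def)
    obtain i where i: "i \<le> k" "\<bar>y \<bullet> b i\<bar> = 1" using yU(2) by (metis box_norm_attained)
    have "y \<bullet> b k = - 1"
    proof -
      have "\<not> i < k" using False y i unfolding box_lid_def by blast
      then have "i = k" using i by simp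
      moreover have "y \<bullet> b k \<noteq> 1" using False y unfolding box_lid_def by blast
      ultimately show ?thesis using i by (auto simp: abs_if split: if_splits)
    qed
    then show ?thesis
      using bottom_coords[OF yU(1)] by (simp add: F'_def h(2) g_def)
  qed
  have "homotopic_with_canon (\<lambda>x. True) box_boundary X F' f"
    by (rule homotopic_with_eq[OF homotopic_with_symD[OF f'(1)]]) (auto simp: F'_on_boundary)
  then obtain F where "continuous_on unit_box F" "F ` unit_box \<subseteq> X" "\<And>v. v \<in> box_boundary \<Longrightarrow> F v = f v"
    using Borsuk_homotopy_extension_homotopic[OF closedin_boundary _ F'_cont F'_X] anr by metis
  then show thesis using that by blast
qed

end

section \<open>Complexified complements and linear forms\<close>

definition re_vec :: "complex ^ 'l \<Rightarrow> real ^ 'l" where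
  "re_vec z = (\<chi> j. Re (z $ j))"

definition im_vec :: "complex ^ 'l \<Rightarrow> real ^ 'l" where
  "im_vec z = (\<chi> j. Im (z $ j))"

definition complex_vec :: "real ^ 'l \<Rightarrow> real ^ 'l \<Rightarrow> complex ^ 'l" where
  "complex_vec x y = (\<chi> j. Complex (x $ j) (y $ j))"

lemma re_complex_vec [simp]: "re_vec (complex_vec x y) = x"
  and im_complex_vec [simp]: "im_vec (complex_vec x y) = y"
  by (simp_all add: re_vec_def im_vec_def complex_vec_def)

lemma complex_vec_re_im: "complex_vec (re_vec z) (im_vec z) = z"
  by (simp add: re_vec_def im_vec_def complex_vec_def vec_eq_iff)

lemma continuous_on_re_vec [continuous_intros]:
    "continuous_on S f \<Longrightarrow> continuous_on S (\<lambda>x. re_vec (f x))"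
  and continuous_on_im_vec [continuous_intros]:
    "continuous_on S f \<Longrightarrow> continuous_on S (\<lambda>x. im_vec (f x))"
  and continuous_on_complex_vec [continuous_intros]:
    "continuous_on S g \<Longrightarrow> continuous_on S h \<Longrightarrow> continuous_on S (\<lambda>x. complex_vec (g x) (h x))"
  unfolding re_vec_def im_vec_def complex_vec_def
  by (auto intro!: continuous_intros continuous_on_vec_lambda)

lemma mem_complexified_complement_iff:
  "z \<in> complexified_complement A \<longleftrightarrow> (\<forall>H\<in>A. re_vec z \<in> H \<longrightarrow> im_vec z \<notin> H)"
proof -
  have "z \<in> complexification H \<longleftrightarrow> re_vec z \<in> H \<and> im_vec z \<in> H" for H
    unfolding complexification_def complex_vec_def[symmetric]
    using complex_vec_re_im[of z] by (auto; metis re_complex_vec im_complex_vec)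
  then show ?thesis
    by (auto simp: complexified_complement_def)
qed

definition complex_form :: "(real ^ 'l \<Rightarrow> real) \<Rightarrow> complex ^ 'l \<Rightarrow> complex" where
  "complex_form a z = Complex (a (re_vec z)) (a (im_vec z))"

lemma complex_form_eq_0_iff: "complex_form a z = 0 \<longleftrightarrow> a (re_vec z) = 0 \<and> a (im_vec z) = 0"
  by (simp add: complex_form_def complex_eq_iff)

lemma continuous_on_complex_form:
  assumes "linear a" shows "continuous_on S (complex_form a)"
  unfolding complex_form_def
  by (intro continuous_on_Complex continuous_on_compose2[OF continuous_on_linear_form[OF assms, of UNIV]]
      continuous_intros) auto

lemma complex_form_line:
  assumes "linear a"
  shows "complex_form a (z + t *s u) = complex_form a z + t * complex_form a u"
proof -
  have eqs: "re_vec (z + t *s u) = re_vec z + (Re t *\<^sub>R re_vec u - Im t *\<^sub>R im_vec u)"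
    "im_vec (z + t *s u) = im_vec z + (Re t *\<^sub>R im_vec u + Im t *\<^sub>R re_vec u)"
    by (simp_all add: re_vec_def im_vec_def vec_eq_iff)
  then show ?thesis
    unfolding complex_form_def eqs using assms
    by (simp add: complex_eq_iff linear_add linear_diff linear_scale algebra_simps)
qed

lemma open_forms_nonvanishing:
  assumes "finite I" "\<And>i. i \<in> I \<Longrightarrow> linear (a i)"
  shows "open {z. \<forall>i\<in>I. complex_form (a i) z \<noteq> 0}"
proof -
  have "{z. \<forall>i\<in>I. complex_form (a i) z \<noteq> 0} = (\<Inter>i\<in>I. {z. complex_form (a i) z \<noteq> 0})" by auto
  then show ?thesis
    using assms by (auto intro!: open_INT open_Collect_neq continuous_on_complex_form continuous_intros)
qed

text \<open>Two points of the complement span a complex line. A form that vanishes at neither of them has at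
  most one zero on it, and the complex plane stays path connected when finitely many points are removed.\<close>

lemma path_connected_forms_nonvanishing:
  assumes "finite I" "\<And>i. i \<in> I \<Longrightarrow> linear (a i)"
  shows "path_connected {z. \<forall>i\<in>I. complex_form (a i) z \<noteq> 0}" (is "path_connected ?M")
  unfolding path_connected_component
proof (intro ballI)
  fix z w assume zw: "z \<in> ?M" "w \<in> ?M"
  define l where "l t = z + t *s (w - z)" for t :: complex
  define Z where "Z = (\<Union>i\<in>I. {t. complex_form (a i) z + t * complex_form (a i) (w - z) = 0})"
  have form_l: "complex_form (a i) (l t) = complex_form (a i) z + t * complex_form (a i) (w - z)"
    if "i \<in> I" for i t
    unfolding l_def using complex_form_line assms(2)[OF that] by blast
  have "finite {t. complex_form (a i) z + t * complex_form (a i) (w - z) = 0}" if "i \<in> I" for i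
  proof (rule finite_subset)
    show "{t. complex_form (a i) z + t * complex_form (a i) (w - z) = 0}
        \<subseteq> {- complex_form (a i) z / complex_form (a i) (w - z)}"
      using zw(1) that by (auto simp: eq_divide_eq add_eq_0_iff2 minus_equation_iff)
  qed simp
  then have "finite Z" using assms(1) by (simp add: Z_def)
  then have "path_connected (- Z)"
    by (intro path_connected_complement_countable) (auto simp: countable_finite)
  moreover have "continuous_on (- Z) l"
    unfolding l_def vector_scalar_mult_def
    by (intro continuous_intros continuous_on_vec_lambda)
  ultimately have conn: "path_connected (l ` (- Z))"
    by (rule path_connected_continuous_image[rotated])
  have sub: "l ` (- Z) \<subseteq> ?M" using form_l by (auto simp: Z_def)
  have l01: "l 0 = z" "l 1 = w" by (auto simp: l_def)
  have "0 \<in> - Z" "1 \<in> - Z"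
    using zw form_l[of _ 0] form_l[of _ 1] l01 by (auto simp: Z_def)
  then have "z \<in> l ` (- Z)" "w \<in> l ` (- Z)" using l01 by blast+
  then have "path_component (l ` (- Z)) z w"
    using conn unfolding path_connected_component by blast
  then show "path_component ?M z w"
    using path_component_of_subset[OF sub] by blast
qed

text \<open>Induction on the number of forms: a point \<open>x\<close> that is good for the forms in \<open>K\<close> is moved in a
  direction \<open>y\<close> where the new form does not vanish. Only finitely many step lengths are bad.\<close>

lemma exists_generic_point:
  fixes a :: "'i \<Rightarrow> 'a::real_vector \<Rightarrow> real"
  assumes "finite K" "subspace X" "\<And>i. i \<in> K \<Longrightarrow> linear (a i)" "\<And>i. i \<in> K \<Longrightarrow> \<exists>x\<in>X. a i x \<noteq> 0"
  shows "\<exists>x\<in>X. \<forall>i\<in>K. a i x \<noteq> 0"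
  using assms
proof (induction K rule: finite_induct)
  case empty
  then show ?case using subspace_0 by auto
next
  case (insert j K)
  obtain x where x: "x \<in> X" "\<And>i. i \<in> K \<Longrightarrow> a i x \<noteq> 0" using insert by auto
  obtain y where y: "y \<in> X" "a j y \<noteq> 0" using insert.prems by auto
  have lin: "a i (x + t *\<^sub>R y) = a i x + t * a i y" if "i \<in> insert j K" for i t
    using insert.prems(2)[OF that] by (simp add: linear_add linear_scale)
  have "finite (\<Union>i\<in>insert j K. {t. a i x + t * a i y = 0})"
  proof (intro finite_UN_I)
    fix i assume i: "i \<in> insert j K"
    show "finite {t. a i x + t * a i y = 0}"
    proof (rule finite_subset)
      show "{t. a i x + t * a i y = 0} \<subseteq> {- a i x / a i y}"
        using i x(2)[of i] y(2) by (cases "a i y = 0") (auto simp: eq_divide_eq add_eq_0_iff2 minus_equation_iff)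
    qed simp
  qed (use insert in auto)
  then obtain t where "t \<notin> (\<Union>i\<in>insert j K. {t. a i x + t * a i y = 0})"
    using ex_new_if_finite infinite_UNIV_char_0 by blast
  then have "\<forall>i\<in>insert j K. a i (x + t *\<^sub>R y) \<noteq> 0" using lin by auto
  moreover have "x + t *\<^sub>R y \<in> X"
    using x y insert.prems(1) by (simp add: subspace_add subspace_mul)
  ultimately show ?case by blast
qed

text \<open>For each consistent set \<open>J\<close> of forms fix a vector \<open>y J\<close> on which all of them are positive, and
  weight it at \<open>v\<close> by the product \<open>\<rho> J v\<close> of the absolute values of the other forms. The weight is nonzero
  only if \<open>J\<close> contains all forms that vanish at \<open>v\<close>, so every vector that contributes at \<open>v\<close> is a
  correct choice there. The set of all forms that vanish at \<open>v\<close> does contribute.\<close>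

lemma continuous_choice_of_direction:
  fixes \<beta> :: "'i \<Rightarrow> 'a::euclidean_space \<Rightarrow> real"
  assumes I: "finite I" and lin: "\<And>i. i \<in> I \<Longrightarrow> linear (\<beta> i)"
    and ex: "\<And>v. v \<in> V \<Longrightarrow> \<exists>y. \<forall>i\<in>I. \<beta> i v = 0 \<longrightarrow> 0 < \<beta> i y"
  obtains w where "continuous_on UNIV w" "\<And>v i. v \<in> V \<Longrightarrow> i \<in> I \<Longrightarrow> \<beta> i v = 0 \<Longrightarrow> 0 < \<beta> i (w v)"
proof -
  define C where "C = {J \<in> Pow I. \<exists>y. \<forall>i\<in>J. 0 < \<beta> i y}"
  have finC: "finite C" using I by (simp add: C_def)
  define y where "y J = (SOME y. \<forall>i\<in>J. 0 < \<beta> i y)" for J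
  have y: "0 < \<beta> i (y J)" if "J \<in> C" "i \<in> J" for J i
    using someI_ex[of "\<lambda>y. \<forall>i\<in>J. 0 < \<beta> i y"] that unfolding C_def y_def by blast
  define \<rho> where "\<rho> J v = (\<Prod>i\<in>I - J. \<bar>\<beta> i v\<bar>)" for J v
  define w where "w v = (\<Sum>J\<in>C. \<rho> J v *\<^sub>R y J)" for v
  show thesis
  proof
    show "continuous_on UNIV w"
      unfolding w_def \<rho>_def
      by (intro continuous_intros continuous_on_linear_form lin) auto
    fix v i assume v: "v \<in> V" and i: "i \<in> I" "\<beta> i v = 0"
    let ?J = "{i \<in> I. \<beta> i v = 0}"
    have J: "?J \<in> C" using ex[OF v] by (auto simp: C_def)
    have term_nonneg: "0 \<le> \<rho> J v * \<beta> i (y J)" if "J \<in> C" for J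
    proof (cases "i \<in> J")
      case True
      then show ?thesis
        using y[OF that True] by (simp add: \<rho>_def prod_nonneg)
    next
      case False
      then have "\<rho> J v = 0" using i I by (auto simp: \<rho>_def intro!: prod_zero)
      then show ?thesis by simp
    qed
    have "0 < \<rho> ?J v * \<beta> i (y ?J)"
      using y[OF J, of i] i by (auto simp: \<rho>_def intro!: mult_pos_pos prod_pos)
    also have "\<dots> \<le> (\<Sum>J\<in>C. \<rho> J v * \<beta> i (y J))"
      using J finC term_nonneg by (intro member_le_sum) auto
    also have "\<dots> = \<beta> i (w v)"
      using lin[OF i(1)] by (simp add: w_def linear_sum linear_scale)
    finally show "0 < \<beta> i (w v)" .
  qed
qed

section \<open>Spheres of locally consistent systems of half-spaces\<close>

fun signed_form :: "(real ^ 'l \<Rightarrow> real) \<Rightarrow> sign \<Rightarrow> real ^ 'l \<Rightarrow> real" where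
  "signed_form a Pos x = a x"
| "signed_form a Neg x = - a x"

lemma half_space_eq_signed_form: "half_space a s = {x. 0 < signed_form a s x}"
  by (cases s) auto

lemma linear_signed_form: "linear a \<Longrightarrow> linear (signed_form a s)"
  by (cases s) (auto intro!: linearI simp: linear_add linear_scale)

lemma signed_form_eq_0_iff: "signed_form a s x = 0 \<longleftrightarrow> a x = 0"
  by (cases s) auto

lemma obtain_orthonormal_family:
  fixes X :: "'a::euclidean_space set"
  assumes "subspace X" "dim X + Suc k = DIM('a)"
  obtains b where "orthonormal_family b k" "orthonormal_family.frame_space b k = orthogonal_comp X"
proof -
  have "dim (orthogonal_comp X) = Suc k"
    using dim_subspace_orthogonal_to_vectors[OF assms(1) subspace_UNIV] assms(2)
    by (simp add: orthogonal_comp_def dim_UNIV)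
  then obtain B where B: "pairwise orthogonal B" "\<And>x. x \<in> B \<Longrightarrow> norm x = 1"
      "independent B" "card B = Suc k" "span B = orthogonal_comp X"
    using orthonormal_basis_subspace[OF subspace_orthogonal_comp[of X]] by metis
  have "finite B" using B(4) card.infinite by force
  then obtain b where b: "bij_betw b {..k} B"
    using B(4) ex_bij_betw_nat_finite[of B] by (auto simp: atLeast0LessThan lessThan_Suc_atMost)
  have "orthonormal_family b k"
  proof
    fix i j assume ij: "i \<le> k" "j \<le> k"
    show "b i \<bullet> b j = (if i = j then 1 else 0)"
    proof (cases "i = j")
      case True
      then show ?thesis using B(2)[of "b i"] b ij by (auto simp: bij_betw_def norm_eq_1)
    next
      case False
      then have "b i \<noteq> b j" "b i \<in> B" "b j \<in> B" using b ij by (auto simp: bij_betw_def inj_on_def)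
      then show ?thesis using B(1) False by (auto simp: pairwise_def orthogonal_def)
    qed
  qed
  moreover have "span (b ` {..k}) = orthogonal_comp X" using b B(5) by (simp add: bij_betw_def)
  ultimately show thesis
    using that orthonormal_family.frame_space_def by metis
qed

locale arrangement_with_forms =
  fixes A :: "(real ^ 'l) set set" and n :: nat
    and H :: "nat \<Rightarrow> (real ^ 'l) set" and \<alpha> :: "nat \<Rightarrow> real ^ 'l \<Rightarrow> real"
  assumes central: "central_essential_arrangement A"
    and bij: "bij_betw H {1..n} A"
    and linear_form: "\<And>i. i \<in> {1..n} \<Longrightarrow> linear (\<alpha> i)"
    and kernel: "\<And>i. i \<in> {1..n} \<Longrightarrow> H i = {x. \<alpha> i x = 0}"
begin

lemma A_eq: "A = H ` {1..n}"
  using bij by (simp add: bij_betw_def)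

lemma mem_complement_iff:
  "z \<in> complexified_complement A \<longleftrightarrow> (\<forall>i\<in>{1..n}. complex_form (\<alpha> i) z \<noteq> 0)"
  unfolding mem_complexified_complement_iff A_eq by (auto simp: kernel complex_form_eq_0_iff)

lemma complement_eq: "complexified_complement A = {z. \<forall>i\<in>{1..n}. complex_form (\<alpha> i) z \<noteq> 0}"
  using mem_complement_iff by blast

lemma open_complement: "open (complexified_complement A)"
  unfolding complement_eq by (intro open_forms_nonvanishing linear_form) auto

lemma path_connected_complement: "path_connected (complexified_complement A)"
  unfolding complement_eq by (intro path_connected_forms_nonvanishing linear_form) auto

lemma form_nonzero: 
  assumes "i \<in> {1..n}" shows "\<exists>x. \<alpha> i x \<noteq> 0"
proof (rule ccontr)
  assume "\<not> ?thesis"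
  then have "H i = UNIV" using kernel[OF assms] by auto
  moreover have "linear_hyperplane (H i)"
    using central assms A_eq by (auto simp: central_essential_arrangement_def)
  ultimately show False by (simp add: linear_hyperplane_def dim_UNIV)
qed

lemma complement_nonempty: "complexified_complement A \<noteq> {}"
proof -
  obtain x where "\<forall>i\<in>{1..n}. \<alpha> i x \<noteq> 0"
    using exists_generic_point[of "{1..n}" UNIV \<alpha>] linear_form form_nonzero by auto
  then have "complex_vec x 0 \<in> complexified_complement A"
    by (auto simp: mem_complement_iff complex_form_eq_0_iff)
  then show ?thesis by blast
qed

lemma consistent_at_iff:
  "consistent_at A n H (half_space_system n \<alpha> \<epsilon>) X \<longleftrightarrow>
    (\<exists>y. \<forall>i\<in>{1..n}. X \<subseteq> H i \<longrightarrow> 0 < signed_form (\<alpha> i) (\<epsilon> i) y)"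
proof -
  have "{i \<in> {1..n}. H i \<in> localization A X} = {i \<in> {1..n}. X \<subseteq> H i}"
    by (auto simp: localization_def A_eq)
  then have "consistent_at A n H (half_space_system n \<alpha> \<epsilon>) X \<longleftrightarrow>
      (\<exists>y. y \<in> (\<Inter>i\<in>{i \<in> {1..n}. X \<subseteq> H i}. half_space_system n \<alpha> \<epsilon> i))"
    unfolding consistent_at_def by auto
  also have "\<dots> \<longleftrightarrow> (\<exists>y. \<forall>i\<in>{1..n}. X \<subseteq> H i \<longrightarrow> 0 < signed_form (\<alpha> i) (\<epsilon> i) y)"
    by (intro arg_cong[of _ _ Ex] ext) (auto simp: half_space_system_def half_space_eq_signed_form)
  finally show ?thesis .
qed

lemma subspace_H: "i \<in> {1..n} \<Longrightarrow> subspace (H i)"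
  using kernel linear_form by (simp add: linear_subspace_kernel)

text \<open>The essential sphere is constructed around a point \<open>x\<^sub>0\<close> of \<open>X\<close> that lies on no hyperplane outside
  the localization at \<open>X\<close>, and so small that its real part avoids those hyperplanes. For the
  hyperplanes through \<open>X\<close> only the component orthogonal to \<open>X\<close> matters, and the argument about the
  least argument applies to it after translation by \<open>x\<^sub>0\<close> and rescaling.\<close>

lemma homotopy_group_nonzero_if_inconsistent:
  assumes k: "1 \<le> k"
    and X: "X \<in> intersections A" "codim X = Suc k"
    and consistent: "\<And>Y. Y \<in> intersections A \<Longrightarrow> codim Y \<le> k \<Longrightarrow>
      consistent_at A n H (half_space_system n \<alpha> \<epsilon>) Y"
    and inconsistent: "\<not> consistent_at A n H (half_space_system n \<alpha> \<epsilon>) X"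
    and p: "p \<in> complexified_complement A"
  shows "\<not> homotopy_group_zero k (top_of_set (complexified_complement A)) p"
proof
  assume zero: "homotopy_group_zero k (top_of_set (complexified_complement A)) p"
  define I where "I = {i \<in> {1..n}. X \<subseteq> H i}"
  have I: "finite I" "I \<subseteq> {1..n}" by (auto simp: I_def)
  define \<beta> where "\<beta> i = signed_form (\<alpha> i) (\<epsilon> i)" for i
  have lin: "linear (\<beta> i)" if "i \<in> {1..n}" for i
    using that by (simp add: \<beta>_def linear_signed_form linear_form)
  have \<beta>0: "\<beta> i x = 0 \<longleftrightarrow> \<alpha> i x = 0" for i x
    by (simp add: \<beta>_def signed_form_eq_0_iff)
  obtain B where B: "B \<subseteq> A" "X = \<Inter>B" using X(1) by (auto simp: intersections_def)
  have X_iff: "x \<in> X \<longleftrightarrow> (\<forall>i\<in>I. \<beta> i x = 0)" for x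
  proof
    assume "x \<in> X" then show "\<forall>i\<in>I. \<beta> i x = 0"
      by (auto simp: I_def \<beta>0 kernel)
  next
    assume *: "\<forall>i\<in>I. \<beta> i x = 0"
    show "x \<in> X" unfolding B(2)
    proof
      fix G assume "G \<in> B"
      then obtain i where "i \<in> {1..n}" "G = H i" using B(1) A_eq by auto
      moreover from this have "i \<in> I" using \<open>G \<in> B\<close> B(2) by (auto simp: I_def)
      ultimately show "x \<in> G" using * by (auto simp: \<beta>0 kernel)
    qed
  qed
  have X_eq: "X = (\<Inter>i\<in>I. H i)"
    using X_iff I(2) by (auto simp: \<beta>0 kernel subset_iff)
  have subX: "subspace X" unfolding X_eq
    using subspace_H I(2) by (intro subspace_Inter) auto
  have dimX: "dim X + Suc k = CARD('l)"
    using X(2) by (simp add: codim_def)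
  obtain b where b: "orthonormal_family b k" 
    and frame_space_eq: "orthonormal_family.frame_space b k = orthogonal_comp X"
    using obtain_orthonormal_family[OF subX, of k] dimX by auto
  interpret orthonormal_family b k by (rule b)
  have proj: "\<beta> i (proj x) = \<beta> i x" if "i \<in> I" for i x
  proof -
    have "x - proj x \<in> orthogonal_comp frame_space"
      unfolding orthogonal_comp_def
    proof (intro CollectI ballI)
      fix u assume "u \<in> frame_space"
      then have "u = (\<Sum>j\<le>k. (u \<bullet> b j) *\<^sub>R b j)" using proj_id by (simp add: proj_def)
      moreover have "b j \<bullet> (x - proj x) = 0" if "j \<le> k" for j
        using inner_sum_b[OF that, of "\<lambda>i. x \<bullet> b i"]
        by (simp add: proj_def inner_diff_right inner_commute[of "b j"])
      then have "(\<Sum>j\<le>k. (u \<bullet> b j) *\<^sub>R b j) \<bullet> (x - proj x) = 0"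
        by (simp add: inner_sum_left)
      ultimately show "orthogonal u (x - proj x)" by (simp add: orthogonal_def)
    qed
    then have "x - proj x \<in> X" using frame_space_eq orthogonal_comp_self[OF subX] by simp
    then have "\<beta> i (x - proj x) = 0" using X_iff that by blast
    then show ?thesis using lin I that by (auto simp: linear_diff)
  qed
  have boundary_disjoint_X: "v \<notin> X" if "v \<in> box_boundary" for v
  proof
    assume "v \<in> X"
    moreover have "v \<in> orthogonal_comp X" using that frame_space_eq by (auto simp: box_boundary_def)
    ultimately have "v = 0" by (auto simp: orthogonal_comp_def orthogonal_def)
    then show False using box_boundary_nonzero that by blast
  qed
  have ex: "\<exists>y. \<forall>i\<in>I. \<beta> i v = 0 \<longrightarrow> 0 < \<beta> i y" if "v \<in> box_boundary" for v
  proof -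
    \<comment> \<open>The smallest flat that contains both \<open>X\<close> and \<open>v\<close>.\<close>
    define Y where "Y = (\<Inter>i\<in>{i\<in>I. \<beta> i v = 0}. H i)"
    have "Y = \<Inter>(H ` {i\<in>I. \<beta> i v = 0})" by (simp add: Y_def)
    then have Y: "Y \<in> intersections A"
      using I A_eq unfolding intersections_def by blast
    have "subspace Y" unfolding Y_def using subspace_H I(2) by (intro subspace_Inter) auto
    have "v \<in> Y" using I by (auto simp: Y_def \<beta>0 kernel)
    have "X \<subseteq> Y" unfolding X_eq Y_def by auto
    have "dim X < dim Y"
    proof (rule ccontr)
      assume "\<not> dim X < dim Y"
      then have "X = Y"
        using subspace_dim_equal[OF subX \<open>subspace Y\<close> \<open>X \<subseteq> Y\<close>] by simp
      then show False using \<open>v \<in> Y\<close> boundary_disjoint_X[OF that] by simp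
    qed
    then have "codim Y \<le> k" using dimX by (simp add: codim_def)
    then obtain y where y: "\<And>i. i \<in> {1..n} \<Longrightarrow> Y \<subseteq> H i \<Longrightarrow> 0 < \<beta> i y"
      using consistent[OF Y] unfolding consistent_at_iff \<beta>_def by blast
    have "0 < \<beta> i y" if "i \<in> I" "\<beta> i v = 0" for i
    proof (rule y)
      show "i \<in> {1..n}" using that I by auto
      show "Y \<subseteq> H i" using that by (auto simp: Y_def)
    qed
    then show ?thesis by blast
  qed
  obtain w where w: "continuous_on UNIV w"
    "\<And>v i. v \<in> box_boundary \<Longrightarrow> i \<in> I \<Longrightarrow> \<beta> i v = 0 \<Longrightarrow> 0 < \<beta> i (w v)"
    using continuous_choice_of_direction[of I \<beta> box_boundary] I lin ex by (metis subsetD)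
  define K where "K = {1..n} - I"
  have "\<exists>x\<in>X. \<forall>i\<in>K. \<alpha> i x \<noteq> 0"
  proof (rule exists_generic_point[OF _ subX])
    show "\<exists>x\<in>X. \<alpha> i x \<noteq> 0" if "i \<in> K" for i
      using that kernel[of i] by (auto simp: K_def I_def)
  qed (auto simp: K_def linear_form)
  then obtain x0 where x0: "x0 \<in> X" "\<And>i. i \<in> K \<Longrightarrow> \<alpha> i x0 \<noteq> 0" by blast
  have open_K: "open {x. \<forall>i\<in>K. \<alpha> i x \<noteq> 0}"
  proof -
    have "{x. \<forall>i\<in>K. \<alpha> i x \<noteq> 0} = (\<Inter>i\<in>K. {x. \<alpha> i x \<noteq> 0})" by auto
    then show ?thesis
      by (auto simp: K_def intro!: open_INT open_Collect_neq continuous_on_const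
          continuous_on_linear_form linear_form)
  qed
  obtain e where e_ball: "e > 0" "ball x0 e \<subseteq> {x. \<forall>i\<in>K. \<alpha> i x \<noteq> 0}"
    using openE[OF open_K, of x0] x0(2) by blast
  have e: "e > 0" "\<And>x. dist x0 x < e \<Longrightarrow> \<forall>i\<in>K. \<alpha> i x \<noteq> 0"
    using e_ball by (auto simp: subset_iff)
  obtain N where N: "N > 0" "\<And>x. x \<in> unit_box \<Longrightarrow> norm x \<le> N"
    using compact_imp_bounded[OF compact_box] by (auto simp: bounded_pos)
  define \<delta> where "\<delta> = e / (2 * N)"
  have \<delta>: "\<delta> > 0" using e N by (simp add: \<delta>_def)
  have near: "\<alpha> i (x0 + \<delta> *\<^sub>R v) \<noteq> 0" if "i \<in> K" "v \<in> unit_box" for i v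
  proof -
    have "dist x0 (x0 + \<delta> *\<^sub>R v) = \<delta> * norm v" using \<delta> by (simp add: dist_norm)
    also have "\<dots> \<le> \<delta> * N" using N(2)[OF that(2)] \<delta> by simp
    also have "\<dots> < e" using e N by (simp add: \<delta>_def)
    finally show ?thesis using e(2) that by blast
  qed
  have \<beta>_x0: "\<beta> i x0 = 0" if "i \<in> I" for i
    using X_iff x0(1) that by blast
  define f where "f v = complex_vec (x0 + \<delta> *\<^sub>R v) (\<delta> *\<^sub>R w v)" for v
  have f_in_complement: "f v \<in> complexified_complement A" if "v \<in> box_boundary" for v
    unfolding mem_complement_iff complex_form_eq_0_iff
  proof (intro ballI notI)
    fix i assume i: "i \<in> {1..n}" and "\<alpha> i (re_vec (f v)) = 0 \<and> \<alpha> i (im_vec (f v)) = 0"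
    then have 0: "\<alpha> i (x0 + \<delta> *\<^sub>R v) = 0" "\<alpha> i (\<delta> *\<^sub>R w v) = 0" by (simp_all add: f_def)
    have "v \<in> unit_box" using that box_boundary_subset_box by auto
    then have "i \<in> I" using near[of i v] 0 i by (auto simp: K_def)
    have "\<beta> i (x0 + \<delta> *\<^sub>R v) = 0" "\<beta> i (\<delta> *\<^sub>R w v) = 0" using 0 by (simp_all add: \<beta>0)
    then have "\<beta> i v = 0" "\<beta> i (w v) = 0"
      using lin[OF i] \<beta>_x0[OF \<open>i \<in> I\<close>] \<delta> by (simp_all add: linear_add linear_scale)
    then show False using w(2)[OF that \<open>i \<in> I\<close>] by simp
  qed
  have f_cont: "continuous_on box_boundary f"
    unfolding f_def by (intro continuous_intros continuous_on_subset[OF w(1)]) auto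
  obtain F where F: "continuous_on unit_box F" "F \<in> unit_box \<rightarrow> complexified_complement A"
      "\<And>v. v \<in> box_boundary \<Longrightarrow> F v = f v"
    using sphere_map_extends_if_homotopy_group_zero[OF open_complement path_connected_complement
        p zero f_cont] f_in_complement by blast
  define R where "R x = (1 / \<delta>) *\<^sub>R (re_vec (F x) - x0)" for x
  define S where "S x = (1 / \<delta>) *\<^sub>R im_vec (F x)" for x
  have \<beta>R: "\<beta> i (R x) = \<beta> i (re_vec (F x)) / \<delta>" and \<beta>S: "\<beta> i (S x) = \<beta> i (im_vec (F x)) / \<delta>"
    if "i \<in> I" for i x
    using lin[of i] that I \<beta>_x0[OF that] by (auto simp: R_def S_def linear_diff linear_scale)
  have R_on_boundary: "R v = v" and S_on_boundary: "S v = w v" if "v \<in> box_boundary" for v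
    using \<delta> by (simp_all add: R_def S_def F(3)[OF that] f_def)
  show False
  proof (rule sphere_of_inconsistent_system_not_extendable[where I = I and \<beta> = \<beta> and R = R and S = S])
    show "continuous_on unit_box R" "continuous_on unit_box S"
      unfolding R_def S_def by (intro continuous_intros F(1))+
    show "\<beta> i (S x) \<noteq> 0" if "i \<in> I" "x \<in> unit_box" "\<beta> i (R x) = 0" for i x
    proof -
      have "F x \<in> complexified_complement A" using F(2) that by blast
      then show ?thesis
        using that I \<delta> by (auto simp: mem_complement_iff complex_form_eq_0_iff \<beta>R \<beta>S \<beta>0)
    qed
    show "proj (R v) = v" if "v \<in> box_boundary" for v
      using that R_on_boundary proj_id by (simp add: box_boundary_def)
    show "0 < \<beta> i (S v)" if "i \<in> I" "v \<in> box_boundary" "\<beta> i v = 0" for i v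
      using w(2) that S_on_boundary by simp
    show "\<exists>i\<in>I. \<beta> i y \<le> 0" for y
      using inconsistent unfolding consistent_at_iff I_def \<beta>_def by (force simp: not_less)
  qed (use k I lin proj in auto)
qed

lemma consistent_systems_antimono:
  "j \<le> k \<Longrightarrow> consistent_systems A n H \<alpha> k \<subseteq> consistent_systems A n H \<alpha> j"
  unfolding consistent_systems_def by fastforce

lemma homotopy_group_nonzero:
  assumes k: "1 \<le> k"
    and strict: "consistent_systems A n H \<alpha> (k + 1) \<subset> consistent_systems A n H \<alpha> k"
    and p: "p \<in> complexified_complement A"
  shows "\<not> homotopy_group_zero k (top_of_set (complexified_complement A)) p"
proof -
  obtain \<epsilon> where \<epsilon>: "\<And>Y. Y \<in> intersections A \<Longrightarrow> codim Y \<le> k \<Longrightarrow>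
        consistent_at A n H (half_space_system n \<alpha> \<epsilon>) Y"
      "half_space_system n \<alpha> \<epsilon> \<notin> consistent_systems A n H \<alpha> (k + 1)"
    using strict unfolding consistent_systems_def by blast
  then obtain X where X: "X \<in> intersections A" "codim X \<le> k + 1"
      "\<not> consistent_at A n H (half_space_system n \<alpha> \<epsilon>) X"
    unfolding consistent_systems_def by blast
  then have "codim X = Suc k" using \<epsilon>(1)[OF X(1)] by force
  then show ?thesis
    using homotopy_group_nonzero_if_inconsistent[OF k X(1) _ \<epsilon>(1) X(3) p] by blast
qed

lemma consistent_systems_stable:
  assumes "K_pi_1_space (top_of_set (complexified_complement A))" "2 \<le> k"
  shows "consistent_systems A n H \<alpha> k = consistent_systems A n H \<alpha> 2"
  using assms(2)
proof (induction k rule: dec_induct)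
  case (step k)
  obtain p where p: "p \<in> complexified_complement A" using complement_nonempty by blast
  have "homotopy_group_zero k (top_of_set (complexified_complement A)) p"
    using assms(1) p step by (simp add: K_pi_1_space_def)
  then have "\<not> consistent_systems A n H \<alpha> (k + 1) \<subset> consistent_systems A n H \<alpha> k"
    using homotopy_group_nonzero[OF _ _ p, of k] step by auto
  then show ?case
    using consistent_systems_antimono[of k "k + 1"] step by auto
qed simp

end

theorem theorem5p1:
  fixes A :: "(real ^ 'l) set set"
    and n :: nat
    and H :: "nat \<Rightarrow> (real ^ 'l) set"
    and \<alpha> :: "nat \<Rightarrow> real ^ 'l \<Rightarrow> real"
  assumes "central_essential_arrangement A"
    and "bij_betw H {1..n} A"
    and "\<And>i. i \<in> {1..n} \<Longrightarrow> linear (\<alpha> i)"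
    and "\<And>i. i \<in> {1..n} \<Longrightarrow> H i = {x. \<alpha> i x = 0}"
  shows "(\<forall>k. 2 \<le> k \<and> k + 1 \<le> CARD('l) \<and>
              consistent_systems A n H \<alpha> (k + 1) \<subset> consistent_systems A n H \<alpha> k \<longrightarrow>
            (\<forall>p\<in>complexified_complement A.
               \<not> homotopy_group_zero k (top_of_set (complexified_complement A)) p)) \<and>
         (K_pi_1_space (top_of_set (complexified_complement A)) \<longrightarrow>
            (\<forall>j\<in>{2..CARD('l)}. \<forall>k\<in>{2..CARD('l)}.
               consistent_systems A n H \<alpha> j = consistent_systems A n H \<alpha> k))"
proof -
  interpret arrangement_with_forms A n H \<alpha>
    by (rule arrangement_with_forms.intro) fact+
  show ?thesis
  proof (intro conjI allI impI ballI)
    fix k p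
    assume "2 \<le> k \<and> k + 1 \<le> CARD('l) \<and>
        consistent_systems A n H \<alpha> (k + 1) \<subset> consistent_systems A n H \<alpha> k"
      and "p \<in> complexified_complement A"
    then show "\<not> homotopy_group_zero k (top_of_set (complexified_complement A)) p"
      using homotopy_group_nonzero[of k p] by simp
  next
    fix j k
    assume "K_pi_1_space (top_of_set (complexified_complement A))"
      and "j \<in> {2..CARD('l)}" "k \<in> {2..CARD('l)}"
    then show "consistent_systems A n H \<alpha> j = consistent_systems A n H \<alpha> k"
      using consistent_systems_stable[of j] consistent_systems_stable[of k] by simp
  qed
qed

end
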